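(* Let $p>q>1$ be relatively prime integers and let $\epsilon>0$. Then there exists a finite union of intervals $K\subseteq[0,1)$ of total length at least $1-\epsilon$ such that $Z_{p/q}(K)=\emptyset$.
   Context: For $x\in\mathbb{R}$, $\{x\}=x-\lfloor x\rfloor$ denotes the fractional part. For relatively prime integers $p>q>1$ and $S\subseteq[0,1)$, $Z_{p/q}(S)=\{\xi>0 \mid \{\xi (p/q)^i\}\in S \text{ for every } i\in\mathbb{N}\}$, where $\mathbb{N}=\{0,1,2,\dots\}$. *)

theory Defs
  imports "HOL-Analysis.Analysis"
begin

definition Zpq :: "int \<Rightarrow> int \<Rightarrow> real set \<Rightarrow> real set" where
  "Zpq p q S = {\<xi>::real. \<xi> > 0 \<and> (\<forall>i::nat. frac (\<xi> * (real_of_int p / real_of_int q) ^ i) \<in> S)}"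

end

theory Submission
  imports Defs
begin

text \<open>
  For \<open>x\<^sub>i = \<xi> (p/q)\<^sup>i\<close> and \<open>M = (p q)\<^sup>k\<close>, code the orbit by the integers
  \<open>t\<^sub>i = p \<lfloor>M x\<^sub>i\<rfloor> - q \<lfloor>M x\<^bsub>i+1\<^esub>\<rfloor>\<close>, which take finitely many values. Because of the factor \<open>M\<close>,
  the symbols \<open>t\<^sub>j\<close> with \<open>\<bar>j - i\<bar> < k\<close> depend only on the fractional part of \<open>x\<^sub>i\<close>.
  A greedy marker construction (as in Krieger's marker lemma) selects, by a local shift-invariant
  rule, indices at distance at least \<open>n\<close> from each other, near every place where the code is not
  locally periodic with a period below \<open>n\<close>. The set of fractional parts that produce a marked index
  is a finite union of intervals; since multiplication by integers preserves Lebesgue measure modulo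
  one and the marked indices are \<open>n\<close>-separated, its measure is at most \<open>1/n\<close>. If an orbit never
  meets this set, then \<open>t\<close> is eventually periodic with some period \<open>D\<close>. The differences
  \<open>V\<^sub>i = \<lfloor>M x\<^sub>i\<rfloor> - \<lfloor>M x\<^bsub>i+D\<^esub>\<rfloor>\<close> then satisfy \<open>p V\<^sub>i = q V\<^bsub>i+1\<^esub>\<close>, so they are divisible by every
  power of \<open>q\<close> and vanish, which contradicts \<open>x\<^sub>i \<rightarrow> \<infinity>\<close>.
\<close>

section \<open>Greedy markers on two-sided sequences\<close>

definition occurs_at :: "'a list \<Rightarrow> (int \<Rightarrow> 'a) \<Rightarrow> int \<Rightarrow> bool" where
  "occurs_at w t i \<longleftrightarrow> (\<forall>j<length w. t (i + int j) = w ! j)"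

definition has_period :: "nat \<Rightarrow> 'a list \<Rightarrow> bool" where
  "has_period d w \<longleftrightarrow> (\<forall>j. j + d < length w \<longrightarrow> w ! j = w ! (j + d))"

text \<open>The order of the list is a priority order: the last word is served first, and marks once
  set are never removed.\<close>

fun marker :: "nat \<Rightarrow> 'a list list \<Rightarrow> (int \<Rightarrow> 'a) \<Rightarrow> int \<Rightarrow> bool" where
  "marker n [] t i \<longleftrightarrow> False"
| "marker n (w # ws) t i \<longleftrightarrow>
     marker n ws t i \<or> occurs_at w t i \<and> (\<forall>d. \<bar>d\<bar> < int n \<longrightarrow> \<not> marker n ws t (i + d))"

lemma marker_shift: "marker n ws (\<lambda>j. t (j + a)) i \<longleftrightarrow> marker n ws t (i + a)"
  by (induction ws arbitrary: i) (simp_all add: occurs_at_def add_ac)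

text \<open>Each word enlarges the radius by \<open>n\<close> for conflicting marks and by its
  length for its occurrence. Uniformity in \<open>t\<close> and \<open>i\<close> later makes the
  hole a finite union of intervals.\<close>

lemma marker_local:
  "\<exists>R\<ge>0. \<forall>t t' i. (\<forall>j. \<bar>j - i\<bar> \<le> R \<longrightarrow> t j = t' j) \<longrightarrow> marker n ws t i = marker n ws t' i"
proof (induction ws)
  case Nil
  show ?case by auto
next
  case (Cons w ws)
  then obtain R where R: "R \<ge> 0"
    "\<And>t t' i. (\<forall>j. \<bar>j - i\<bar> \<le> R \<longrightarrow> t j = t' j) \<Longrightarrow> marker n ws t i = marker n ws t' i"
    by metis
  show ?case
  proof (intro exI[of _ "R + int n + int (length w)"] conjI allI impI)
    show "0 \<le> R + int n + int (length w)" using R(1) by simp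
    fix t t' :: "int \<Rightarrow> 'a" and i
    assume eq: "\<forall>j. \<bar>j - i\<bar> \<le> R + int n + int (length w) \<longrightarrow> t j = t' j"
    have "marker n ws t (i + d) = marker n ws t' (i + d)" if "\<bar>d\<bar> < int n" for d
      by (rule R(2)) (use eq that in auto)
    moreover have "marker n ws t i = marker n ws t' i"
      by (rule R(2)) (use eq in auto)
    moreover have "occurs_at w t i = occurs_at w t' i"
      unfolding occurs_at_def using eq R(1) by auto
    ultimately show "marker n (w # ws) t i = marker n (w # ws) t' i"
      by auto
  qed
qed

text \<open>Close marks from different stages are excluded by the greedy rule. Close marks from one
  stage come from overlapping copies of one word, which would give it the period \<open>d\<close>.
  As \<open>has_period d w\<close> is vacuous for \<open>d >= length w\<close>, the hypothesis also
  ensures that the copies overlap.\<close>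

lemma marker_separated:
  assumes "\<And>w d. w \<in> set ws \<Longrightarrow> 0 < d \<Longrightarrow> d < n \<Longrightarrow> \<not> has_period d w"
    and "marker n ws t i" "marker n ws t (i + int d)" "0 < d" "d < n"
  shows False
  using assms
proof (induction ws)
  case Nil
  then show ?case by simp
next
  case (Cons w ws)
  have "\<not> (occurs_at w t i \<and> occurs_at w t (i + int d))"
  proof
    assume o: "occurs_at w t i \<and> occurs_at w t (i + int d)"
    obtain j where j: "j + d < length w" "w ! j \<noteq> w ! (j + d)"
      using Cons.prems(1)[of w d] Cons.prems(4,5) by (auto simp: has_period_def)
    have "w ! j = t (i + int d + int j)" "w ! (j + d) = t (i + int (j + d))"
      using o j(1) by (auto simp: occurs_at_def)
    with j show False by (simp add: add_ac)
  qed
  moreover have "\<not> (marker n ws t i \<and> marker n ws t (i + int d))"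
    using Cons by auto
  moreover have "\<not> (marker n ws t i \<and> \<not> marker n ws t (i + int d) \<and> marker n (w # ws) t (i + int d))"
    using Cons.prems(5) by (auto intro!: exI[of _ "- int d"])
  moreover have "\<not> (marker n ws t (i + int d) \<and> \<not> marker n ws t i \<and> marker n (w # ws) t i)"
    using Cons.prems(5) by (auto intro!: exI[of _ "int d"])
  ultimately show ?case
    using Cons.prems(2,3) by auto
qed

lemma marker_covers:
  assumes "w \<in> set ws" "occurs_at w t i" "n > 0"
  shows "\<exists>d. \<bar>d\<bar> < int n \<and> marker n ws t (i + d)"
  using assms
proof (induction ws)
  case Nil
  then show ?case by simp
next
  case (Cons v ws)
  show ?case
  proof (cases "\<exists>d. \<bar>d\<bar> < int n \<and> marker n ws t (i + d)")
    case True
    then show ?thesis by auto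
  next
    case False
    with Cons have "marker n (v # ws) t (i + 0)" by auto
    then show ?thesis using \<open>n > 0\<close> by (intro exI[of _ 0]) auto
  qed
qed

text \<open>The local period \<open>d < n\<close> may change from window to window, but each such
  \<open>d\<close> divides \<open>fact n\<close>, and the window reaches exactly to
  \<open>i + fact n\<close>. The bound \<open>i >= int n\<close> keeps the nearby mark given by
  \<open>marker_covers\<close> at a nonnegative index.\<close>

lemma marker_free_periodic:
  fixes t :: "int \<Rightarrow> 'a"
  assumes A: "\<And>i. t i \<in> A" and n: "n > 0"
    and ws: "set ws = {w. set w \<subseteq> A \<and> length w = Suc (fact n) \<and>
      (\<forall>d. 0 < d \<and> d < n \<longrightarrow> \<not> has_period d w)}"
    and free: "\<And>i. i \<ge> 0 \<Longrightarrow> \<not> marker n ws t i"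
    and i: "i \<ge> int n"
  shows "t (i + fact n) = t i"
proof -
  define w where "w = map (\<lambda>j. t (i + int j)) [0..<Suc (fact n)]"
  have len: "length w = Suc (fact n)" by (simp add: w_def)
  have nth: "w ! j = t (i + int j)" if "j \<le> fact n" for j
    using that unfolding w_def by (subst nth_map) (auto simp del: upt_Suc simp: less_Suc_eq_le)
  have "occurs_at w t i" by (auto simp: occurs_at_def len nth)
  have "w \<notin> set ws"
  proof
    assume "w \<in> set ws"
    from marker_covers[OF this \<open>occurs_at w t i\<close> n] obtain d
      where "\<bar>d\<bar> < int n" "marker n ws t (i + d)" by blast
    moreover from this i have "i + d \<ge> 0" by linarith
    ultimately show False using free by blast
  qed
  moreover have "set w \<subseteq> A" using A by (auto simp: w_def)
  ultimately obtain d where d: "0 < d" "d < n" "has_period d w"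
    using ws len by auto
  have step: "m * d \<le> fact n \<Longrightarrow> w ! (m * d) = w ! 0" for m
  proof (induction m)
    case (Suc m)
    then show ?case
      using d(3) len unfolding has_period_def by (auto simp: add.commute dest!: spec[of _ "m * d"])
  qed simp
  obtain m where "fact n = d * m"
    using dvd_fact[of d n] d by (auto elim: dvdE)
  then have "w ! fact n = w ! 0" using step[of m] by (simp add: mult.commute)
  then show ?thesis using nth[of "fact n"] nth[of 0] by simp
qed

section \<open>Counting and divisibility\<close>

lemma card_div_mod:
  fixes r m Q :: nat
  assumes "r > 0" "C \<subseteq> {..<Q}"
  shows "card {c\<in>{..<r * m * Q}. (c div r) mod Q \<in> C} = r * m * card C"
proof -
  \<comment> \<open>Unique expansion c = (a Q + b) r + e. On the grid of mesh 1/(r m Q), this counts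
    the preimage of the cells \<open>C\<close> under multiplication by \<open>m\<close> modulo
    one.\<close>
  have "bij_betw (\<lambda>(a, b, e). (a * Q + b) * r + e) ({..<m} \<times> C \<times> {..<r})
          {c\<in>{..<r * m * Q}. (c div r) mod Q \<in> C}"
  proof (rule bij_betw_byWitness[where f' = "\<lambda>c. (c div r div Q, c div r mod Q, c mod r)"])
    show "\<forall>x\<in>{..<m} \<times> C \<times> {..<r}. (\<lambda>c. (c div r div Q, c div r mod Q, c mod r))
            ((\<lambda>(a, b, e). (a * Q + b) * r + e) x) = x"
      using assms by (auto simp: subset_iff)
    show "\<forall>c\<in>{c\<in>{..<r * m * Q}. (c div r) mod Q \<in> C}. (\<lambda>(a, b, e). (a * Q + b) * r + e)
            (c div r div Q, c div r mod Q, c mod r) = c"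
      by simp
    show "(\<lambda>(a, b, e). (a * Q + b) * r + e) ` ({..<m} \<times> C \<times> {..<r})
            \<subseteq> {c\<in>{..<r * m * Q}. (c div r) mod Q \<in> C}"
    proof (rule image_subsetI)
      fix x assume "x \<in> {..<m} \<times> C \<times> {..<r}"
      then obtain a b e where x: "x = (a, b, e)" and abe: "a < m" "b \<in> C" "e < r"
        by auto
      then have b: "b < Q" using assms by auto
      have "(a * Q + b) * r + e < (a * Q + b + 1) * r" using abe by simp
      also have "\<dots> \<le> ((a + 1) * Q) * r" using b by (intro mult_right_mono) auto
      also have "\<dots> \<le> m * Q * r" using abe by (intro mult_right_mono) auto
      finally have "(a * Q + b) * r + e < r * m * Q" by (simp add: mult_ac)
      then show "(\<lambda>(a, b, e). (a * Q + b) * r + e) x \<in> {c\<in>{..<r * m * Q}. (c div r) mod Q \<in> C}"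
        using abe b by (simp add: x)
    qed
    show "(\<lambda>c. (c div r div Q, c div r mod Q, c mod r)) ` {c\<in>{..<r * m * Q}. (c div r) mod Q \<in> C}
            \<subseteq> {..<m} \<times> C \<times> {..<r}"
      using assms(1) by (auto simp: less_mult_imp_div_less mult_ac)
  qed
  then have "card {c\<in>{..<r * m * Q}. (c div r) mod Q \<in> C} = card ({..<m} \<times> C \<times> {..<r})"
    by (simp add: bij_betw_same_card)
  then show ?thesis by (simp add: card_cartesian_product mult_ac)
qed

lemma int_eq_0_if_powers_dvd:
  fixes v q :: int
  assumes "q > 1" "\<And>m. q ^ m dvd v"
  shows "v = 0"
proof (rule ccontr)
  assume "v \<noteq> 0"
  have "int m < q ^ m" for m
  proof (induction m)
    case (Suc m)
    have "q ^ m * 2 \<le> q ^ m * q" using assms(1) by (intro mult_left_mono) auto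
    then have "2 * q ^ m \<le> q ^ Suc m" by (simp add: mult.commute)
    with Suc show ?case by linarith
  qed simp
  from this[of "nat \<bar>v\<bar>"] have "\<bar>v\<bar> < q ^ nat \<bar>v\<bar>" by simp
  moreover have "q ^ nat \<bar>v\<bar> \<le> \<bar>v\<bar>"
    using dvd_imp_le_int[OF \<open>v \<noteq> 0\<close> assms(2)[of "nat \<bar>v\<bar>"]] assms(1) by simp
  ultimately show False by simp
qed

section \<open>Integer coding of orbits\<close>

locale rational_base =
  fixes p q :: int
  assumes pq: "p > q" "q > 1" and cop: "coprime p q"
begin

abbreviation "\<rho> \<equiv> real_of_int p / real_of_int q"

text \<open>For |j| <= k this is the integer p^(k+j) q^(k-j), so denominators are cleared at
  negative times too.\<close>

definition scl :: "nat \<Rightarrow> int \<Rightarrow> real" where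
  "scl k j = (real_of_int (p * q)) ^ k * \<rho> powi j"

definition code :: "nat \<Rightarrow> real \<Rightarrow> int \<Rightarrow> int" where
  "code k z j = p * \<lfloor>scl k j * z\<rfloor> - q * \<lfloor>scl k (j + 1) * z\<rfloor>"

lemma rho: "\<rho> > 1" using pq by simp

lemma scl_Suc: "q * scl k (j + 1) = p * scl k j"
  using pq rho by (simp add: scl_def power_int_add)

lemma scl_mult: "scl k i * scl n j = scl (k + n) (i + j)"
  using pq rho by (simp add: scl_def power_int_add power_add mult_ac)

lemma scl_nat:
  assumes "\<bar>j\<bar> \<le> int k"
  shows "scl k j = real_of_int (p ^ nat (int k + j) * q ^ nat (int k - j))"
proof -
  have "p ^ nat (int k + j) = (real_of_int p) powi (int k + j)"
    "q ^ nat (int k - j) = (real_of_int q) powi (int k - j)"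
    using assms by (auto simp: power_int_def)
  then show ?thesis
    using pq by (simp add: scl_def power_int_add power_int_diff power_mult_distrib power_int_divide_distrib)
qed

text \<open>The complementary factor is p^(k-j) q^(k+j), so one modulus serves all
  \<open>j\<close>.\<close>

lemma scl_dvd:
  assumes "\<bar>j\<bar> \<le> int k"
  obtains m r :: nat where "scl k j = real m" "m > 0" "r > 0" "m * r = nat (p * q) ^ (2 * k)"
proof -
  define a b where "a = nat (int k + j)" and "b = nat (int k - j)"
  have ab: "a + b = 2 * k" using assms by (auto simp: a_def b_def)
  define P Q where "P = nat p" and "Q = nat q"
  have PQ: "p = int P" "q = int Q" "P > 0" "Q > 0" using pq by (auto simp: P_def Q_def)
  show thesis
  proof
    show "scl k j = real (P ^ a * Q ^ b)"
      unfolding scl_nat[OF assms] a_def[symmetric] b_def[symmetric] by (simp add: PQ)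
    show "P ^ a * Q ^ b * (P ^ b * Q ^ a) = nat (p * q) ^ (2 * k)"
      unfolding ab[symmetric] by (simp add: PQ power_add power_mult_distrib nat_mult_distrib mult_ac)
  qed (use PQ in auto)
qed

text \<open>By \<open>scl_Suc\<close> the terms without floors cancel, leaving a combination of two
  fractional parts.\<close>

lemma code_range: "code k z j \<in> {-p..q}"
proof -
  have "real_of_int (code k z j) = q * frac (scl k (j + 1) * z) - p * frac (scl k j * z)"
    using scl_Suc[of k j] by (simp add: code_def frac_def algebra_simps)
  moreover have "0 \<le> q * frac (scl k (j + 1) * z)" "q * frac (scl k (j + 1) * z) \<le> q * 1"
    "0 \<le> p * frac (scl k j * z)" "p * frac (scl k j * z) \<le> p * 1"
    using pq by (auto intro!: mult_left_mono mult_nonneg_nonneg simp: less_imp_le[OF frac_lt_1])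
  ultimately have "real_of_int (-p) \<le> real_of_int (code k z j)" "real_of_int (code k z j) \<le> real_of_int q"
    by simp_all
  then show ?thesis by (simp only: of_int_le_iff atLeastAtMost_iff)
qed

lemma code_scale: "code k (scl n j * z) i = code (k + n) z (i + j)"
  unfolding code_def mult.assoc[symmetric] scl_mult by (simp add: add_ac)

text \<open>Both scales are integers, and the two integer contributions of \<open>c\<close> cancel
  by \<open>scl_Suc\<close>. The bound is strict because \<open>j + 1\<close> occurs as
  well.\<close>

lemma code_add_int:
  assumes "\<bar>j\<bar> < int k"
  shows "code k (z + of_int c) j = code k z j"
proof -
  obtain m1 :: nat where m1: "scl k j = real m1"
    using assms by (auto intro: scl_dvd[of j k])
  obtain m2 :: nat where m2: "scl k (j + 1) = real m2"
    using assms by (auto intro: scl_dvd[of "j + 1" k])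
  note m = m1 m2
  have "q * int m2 = p * int m1"
    using scl_Suc[of k j] unfolding m by (metis of_int_eq_iff of_int_mult of_int_of_nat_eq)
  moreover have "\<lfloor>real m * (z + of_int c)\<rfloor> = \<lfloor>real m * z\<rfloor> + int m * c" for m
    by (metis distrib_left floor_add_int of_int_mult of_int_of_nat_eq)
  ultimately show ?thesis
    unfolding code_def m by (simp add: distrib_left flip: mult.assoc)
qed

text \<open>If \<open>scl k i = m\<close> and \<open>m * r = Q\<close>, then floor(m z) = floor(Q z)
  div r, so the code is constant on cells of length 1/Q.\<close>

lemma code_floor:
  assumes "\<bar>j\<bar> < int k" and Q: "Q = nat (p * q) ^ (2 * k)"
  shows "code k (of_int \<lfloor>real Q * z\<rfloor> / real Q) j = code k z j"
proof -
  have "\<lfloor>scl k i * (of_int \<lfloor>real Q * z\<rfloor> / real Q)\<rfloor> = \<lfloor>scl k i * z\<rfloor>" if i: "\<bar>i\<bar> \<le> int k" for i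
  proof -
    obtain m r :: nat where mr: "scl k i = real m" "m > 0" "r > 0" "m * r = Q"
      using scl_dvd[OF i] Q by metis
    have *: "scl k i * (y / real Q) = y / real_of_int (int r)" for y
      using mr by (auto simp: mr(4)[symmetric])
    have "scl k i * z = real Q * z / real_of_int (int r)"
      using mr by (auto simp: mr(4)[symmetric])
    then show ?thesis
      unfolding * by (simp only: floor_divide_real_eq_div floor_divide_of_int_eq of_nat_0_le_iff)
  qed
  then show ?thesis using assms(1) by (simp add: code_def)
qed

lemma code_aperiodic:
  assumes "\<xi> > 0" "D > 0"
    and per: "\<And>i. i \<ge> n \<Longrightarrow> code k \<xi> (int i + int D) = code k \<xi> (int i)"
  shows False
proof -
  define U where "U i = \<lfloor>scl k (int i) * \<xi>\<rfloor>" for i :: nat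
  define V where "V i = U i - U (i + D)" for i
  have rec: "p * V i = q * V (Suc i)" if "i \<ge> n" for i
    using per[OF that] by (simp add: V_def U_def code_def algebra_simps)
  have "q ^ m dvd V i" if "i \<ge> n" for m i
    using that
  proof (induction m arbitrary: i)
    case (Suc m)
    then have "q ^ Suc m dvd p * V i" using rec[of i] by simp
    then show ?case
      using cop by (metis coprime_commute coprime_dvd_mult_right_iff coprime_power_left_iff)
  qed simp
  then have V0: "V i = 0" if "i \<ge> n" for i
    using int_eq_0_if_powers_dvd[of q "V i"] that pq by blast
  have U: "U (n + m * D) = U n" for m
  proof (induction m)
    case (Suc m)
    then show ?case using V0[of "n + m * D"] by (simp add: V_def add_ac)
  qed simp
  \<comment> \<open>\<open>U\<close> is constant along the progression \<open>n + m * D\<close>,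
    while the scaled orbit eventually exceeds \<open>U n + 1\<close>.\<close>
  have M: "(real_of_int (p * q)) ^ k * \<xi> > 0" using pq assms(1) by simp
  obtain m where m: "(of_int (U n) + 1) / ((real_of_int (p * q)) ^ k * \<xi>) < \<rho> ^ m"
    using real_arch_pow[OF rho] by blast
  have "m \<le> n + m * D" using assms(2) by (simp add: trans_le_add2)
  then have "\<rho> ^ m \<le> \<rho> ^ (n + m * D)" using rho by (intro power_increasing) auto
  with m have "(of_int (U n) + 1) / ((real_of_int (p * q)) ^ k * \<xi>) < \<rho> ^ (n + m * D)" by linarith
  then have "of_int (U n) + 1 < \<rho> ^ (n + m * D) * ((real_of_int (p * q)) ^ k * \<xi>)"
    using M by (simp add: pos_divide_less_eq)
  also have "\<dots> = scl k (int (n + m * D)) * \<xi>"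
    unfolding scl_def power_int_of_nat by (simp add: mult_ac)
  also have "\<dots> < of_int (U (n + m * D)) + 1" unfolding U_def by linarith
  finally show False using U by simp
qed

section \<open>A small hole that every orbit meets\<close>

lemma exists_hole:
  assumes "n > 0"
  shows "\<exists>Q::nat. \<exists>C. Q > 0 \<and> C \<subseteq> {..<Q} \<and> n * card C \<le> Q \<and>
    (\<forall>\<xi>>0. \<exists>i::nat. \<lfloor>real Q * frac (\<xi> * \<rho> ^ i)\<rfloor> \<in> int ` C)"
proof -
  define W where "W = {w::int list. set w \<subseteq> {-p..q} \<and> length w = Suc (fact n) \<and>
      (\<forall>d. 0 < d \<and> d < n \<longrightarrow> \<not> has_period d w)}"
  have "finite W"
    by (rule finite_subset[OF _ finite_lists_length_eq[of "{-p..q}" "Suc (fact n)"]]) (auto simp: W_def)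
  then obtain ws where ws: "set ws = W" using finite_list by blast
  obtain R where R: "R \<ge> 0"
    "\<And>t t' i. (\<forall>j. \<bar>j - i\<bar> \<le> R \<longrightarrow> t j = t' j) \<Longrightarrow> marker n ws t i = marker n ws t' i"
    using marker_local[of n ws] by metis
  \<comment> \<open>The window |j| <= R must lie within |j| < k, where the code is periodic modulo
    one and constant on cells.\<close>
  define k where "k = nat (R + 1)"
  have k: "int k = R + 1" using R by (simp add: k_def)
  define Q where "Q = nat (p * q) ^ (2 * k)"
  have pq0: "p * q > 0" using pq by simp
  have Q0: "Q > 0" using pq0 by (simp add: Q_def)
  define P where "P z \<longleftrightarrow> marker n ws (code k z) 0" for z
  define C where "C = {c\<in>{..<Q}. P (real c / real Q)}"
  have P_int: "P (z + of_int c) = P z" for z c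
    unfolding P_def by (rule R(2)) (use k in \<open>auto intro!: code_add_int\<close>)
  have P_floor: "P (of_int \<lfloor>real Q * z\<rfloor> / real Q) = P z" for z
    unfolding P_def by (rule R(2)) (use k in \<open>auto intro!: code_floor[OF _ Q_def]\<close>)
  have P_mod: "P (real c / real Q) \<longleftrightarrow> c mod Q \<in> C" for c
  proof -
    have "real c = real (c mod Q) + real (c div Q) * real Q"
      by (metis add.commute div_mult_mod_eq of_nat_add of_nat_mult)
    then have "real c / real Q = real (c mod Q) / real Q + of_int (int (c div Q))"
      using Q0 by (simp add: field_simps)
    then show ?thesis using Q0 by (simp only: P_int) (simp add: C_def)
  qed
  \<comment> \<open>For fixed \<open>l\<close> and \<open>z\<close>, all these conditions read marks
    of one sequence, so \<open>marker_separated\<close> applies across different \<open>j\<close>.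
    The case \<open>l = 0\<close> is the orbit itself.\<close>
  have P_orbit: "P (scl l j * z) \<longleftrightarrow> marker n ws (code (k + l) z) j" for l j z
    unfolding P_def code_scale using marker_shift[of n ws "code (k + l) z" j 0] by simp
  \<comment> \<open>\<open>B\<close> is a common multiple of the multipliers \<open>scl n j\<close>
    with 0 <= j < n, so one grid of mesh 1/(B Q) resolves all the preimages.\<close>
  define B where "B = nat (p * q) ^ (2 * n)"
  have B0: "B > 0" using pq0 by (simp add: B_def)
  \<comment> \<open>\<open>card (E j) / (B Q)\<close> is the measure of the preimage of the hole under multiplication by
    \<open>scl n j\<close> modulo one; these preimages are disjoint for \<open>j < n\<close>.\<close>
  define E where "E j = {c\<in>{..<B * Q}. P (scl n (int j) * (real c / real (B * Q)))}" for j
  have cardE: "card (E j) = B * card C" if j: "j < n" for j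
  proof -
    obtain m r :: nat where mr: "scl n (int j) = real m" "m > 0" "r > 0" "m * r = B"
      unfolding B_def by (rule scl_dvd[of "int j" n]) (use j in auto)
    have "P (scl n (int j) * (real c / real (B * Q))) \<longleftrightarrow> (c div r) mod Q \<in> C" for c
    proof -
      have "scl n (int j) * (real c / real (B * Q)) = real c / real r / real Q"
        using mr by (simp add: mr(4)[symmetric])
      moreover have "\<lfloor>real Q * (real c / real r / real Q)\<rfloor> = int (c div r)"
        using Q0 by (simp add: floor_divide_of_nat_eq)
      ultimately show ?thesis using P_floor[of "real c / real r / real Q"] P_mod[of "c div r"] by simp
    qed
    then have "E j = {c\<in>{..<r * m * Q}. (c div r) mod Q \<in> C}"
      using mr(4) by (auto simp: E_def mult_ac)
    then show ?thesis using card_div_mod[OF mr(3), of C Q m] mr(4) by (auto simp: C_def mult_ac)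
  qed
  have disj: "E i \<inter> E j = {}" if "i < j" "j < n" for i j
  proof -
    have "\<not> (marker n ws t (int i) \<and> marker n ws t (int j))" for t
      using marker_separated[of ws n t "int i" "j - i"] that ws less_imp_diff_less[of j n i]
      by (auto simp: W_def)
    then show ?thesis unfolding E_def P_orbit by blast
  qed
  have "card (\<Union>j\<in>{..<n}. E j) = (\<Sum>j\<in>{..<n}. card (E j))"
  proof (rule card_UN_disjoint)
    show "\<forall>i\<in>{..<n}. \<forall>j\<in>{..<n}. i \<noteq> j \<longrightarrow> E i \<inter> E j = {}"
      using disj by (metis Int_commute lessThan_iff linorder_neqE_nat)
  qed (auto simp: E_def)
  also have "\<dots> = n * (B * card C)" using cardE by simp
  finally have "n * (B * card C) = card (\<Union>j\<in>{..<n}. E j)" by simp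
  also have "\<dots> \<le> card {..<B * Q}" by (rule card_mono) (auto simp: E_def)
  finally have "n * card C \<le> Q" using B0 by (simp add: mult.left_commute)
  moreover have "\<exists>i::nat. \<lfloor>real Q * frac (\<xi> * \<rho> ^ i)\<rfloor> \<in> int ` C" if "\<xi> > 0" for \<xi>
  proof (rule ccontr)
    assume none: "\<nexists>i::nat. \<lfloor>real Q * frac (\<xi> * \<rho> ^ i)\<rfloor> \<in> int ` C"
    have "\<not> marker n ws (code k \<xi>) (int i)" for i :: nat
    proof
      define f where "f = frac (\<xi> * \<rho> ^ i)"
      assume "marker n ws (code k \<xi>) (int i)"
      then have "P (scl 0 (int i) * \<xi>)" using P_orbit[of 0 "int i" \<xi>] by simp
      also have "scl 0 (int i) * \<xi> = f + of_int \<lfloor>\<xi> * \<rho> ^ i\<rfloor>"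
        by (simp add: scl_def f_def frac_def mult.commute)
      finally have "P f" by (simp only: P_int)
      have f: "0 \<le> f" "f < 1" by (auto simp: f_def frac_lt_1)
      define c where "c = nat \<lfloor>real Q * f\<rfloor>"
      have c: "int c = \<lfloor>real Q * f\<rfloor>" using f by (simp add: c_def)
      have "real Q * f < real Q" using f Q0 by simp
      then have "c < Q" using c by linarith
      moreover have "P (real c / real Q)"
        using \<open>P f\<close> P_floor[of f] unfolding c[symmetric] by simp
      ultimately have "c \<in> C" by (simp add: C_def)
      with none c show False unfolding f_def by (metis imageI)
    qed
    then have "\<not> marker n ws (code k \<xi>) i" if "i \<ge> 0" for i
      using that by (metis nonneg_int_cases)
    then have "code k \<xi> (i + fact n) = code k \<xi> i" if "i \<ge> int n" for i
      using marker_free_periodic[of "code k \<xi>" "{-p..q}" n ws i] code_range assms ws that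
      unfolding W_def by blast
    then show False
      using code_aperiodic[OF that, of "fact n" n k] by simp
  qed
  moreover have "C \<subseteq> {..<Q}" by (auto simp: C_def)
  ultimately show ?thesis using Q0 by blast
qed

end

section \<open>Closed intervals avoiding the hole\<close>

theorem theorem4:
  fixes p q :: int and \<epsilon> :: real
  assumes "p > q" and "q > 1" and "coprime p q" and "\<epsilon> > 0"
  shows "\<exists>(I :: (real \<times> real) set) K.
           finite I \<and> K = (\<Union>(a, b)\<in>I. {a..b}) \<and> K \<subseteq> {0..<1} \<and>
           measure lborel K \<ge> 1 - \<epsilon> \<and> Zpq p q K = {}"
proof -
  interpret rational_base p q using assms by unfold_locales
  \<comment> \<open>The hole and the trimming each cost at most a factor 1 - 1/n, and (1 - 1/n)^2 >=
    1 - 2/n.\<close>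
  obtain n0 :: nat where "n0 > 2 / \<epsilon>" using reals_Archimedean2 by blast
  define n where "n = Suc n0"
  have n: "n > 0" "2 / real n < \<epsilon>"
  proof -
    have "2 / \<epsilon> < real n" using \<open>n0 > 2 / \<epsilon>\<close> by (simp add: n_def)
    then show "2 / real n < \<epsilon>" using assms(4) by (simp add: field_simps n_def)
  qed (simp add: n_def)
  obtain Q :: nat and C where QC: "Q > 0" "C \<subseteq> {..<Q}" "n * card C \<le> Q"
    and hit: "\<And>\<xi>. \<xi> > 0 \<Longrightarrow> \<exists>i::nat. \<lfloor>real Q * frac (\<xi> * \<rho> ^ i)\<rfloor> \<in> int ` C"
    using exists_hole[OF n(1)] by blast
  define A where "A = {..<Q} - C"
  \<comment> \<open>The complement of the hole consists of half-open intervals; each is cut by the proportion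
    \<open>1/n\<close> to make it closed.\<close>
  define lo hi where "lo c = real c / real Q" and "hi c = (real c + 1 - 1 / real n) / real Q" for c :: nat
  define J where "J c = {lo c..hi c}" for c
  define K where "K = (\<Union>c\<in>A. J c)"
  have floorJ: "\<lfloor>real Q * x\<rfloor> = int c" if "x \<in> J c" for x c
  proof -
    have "real c \<le> real Q * x" "real Q * x \<le> real c + 1 - 1 / real n"
      using that QC(1) by (auto simp: J_def lo_def hi_def field_simps)
    moreover have "1 / real n > 0" using n by simp
    ultimately show ?thesis by linarith
  qed
  have le: "lo c \<le> hi c" for c
    unfolding lo_def hi_def using n QC(1) by (intro divide_right_mono) auto
  have len: "hi c - lo c = (1 - 1 / real n) / real Q" for c
    by (simp add: hi_def lo_def diff_divide_distrib add_divide_distrib)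
  have "measure lborel K = (\<Sum>c\<in>A. measure lborel (J c))"
    unfolding K_def
  proof (rule measure_finite_Union)
    show "disjoint_family_on J A" unfolding disjoint_family_on_def using floorJ
      by (metis disjoint_iff of_nat_eq_iff)
  qed (auto simp: A_def J_def emeasure_lborel_Icc_eq)
  also have "\<dots> = real (card A) * ((1 - 1 / real n) / real Q)"
    using le len by (simp add: J_def)
  also have "\<dots> = (real (card A) / real Q) * (1 - 1 / real n)" by simp
  also have "\<dots> \<ge> (1 - 1 / real n) * (1 - 1 / real n)"
  proof (rule mult_right_mono)
    have "card A = Q - card C" "card C \<le> Q"
      using QC(2) card_mono[OF _ QC(2)] by (auto simp: A_def card_Diff_subset finite_subset)
    then have cA: "real (card A) = real Q - real (card C)" by simp
    have "real n * real (card C) \<le> real Q" using QC(3) by (metis of_nat_le_iff of_nat_mult)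
    then have "real (card C) / real Q \<le> 1 / real n" using n QC(1) by (simp add: field_simps)
    then show "1 - 1 / real n \<le> real (card A) / real Q"
      using QC(1) by (simp add: cA diff_divide_distrib)
    show "0 \<le> 1 - 1 / real n" using n by simp
  qed
  also have "(1 - 1 / real n) * (1 - 1 / real n) = 1 - 2 / real n + (1 / real n)\<^sup>2"
    by (simp add: power2_eq_square algebra_simps)
  finally have "measure lborel K \<ge> 1 - 2 / real n + (1 / real n)\<^sup>2" by simp
  then have meas: "measure lborel K \<ge> 1 - \<epsilon>" using n(2) zero_le_power2[of "1 / real n"] by linarith
  have sub: "K \<subseteq> {0..<1}"
  proof
    fix x assume "x \<in> K"
    then obtain c where c: "c < Q" "x \<in> J c" by (auto simp: K_def A_def)
    then have "0 \<le> lo c" "lo c \<le> x" by (auto simp: J_def lo_def)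
    moreover have "real Q * x < real Q * 1" using floorJ[OF c(2)] c(1) by linarith
    ultimately show "x \<in> {0..<1}" using QC(1) by auto
  qed
  have "Zpq p q K = {}"
  proof (rule ccontr)
    assume "Zpq p q K \<noteq> {}"
    then obtain \<xi> where \<xi>: "\<xi> > 0" "\<And>i::nat. frac (\<xi> * \<rho> ^ i) \<in> K" by (auto simp: Zpq_def)
    obtain i :: nat and c where "\<lfloor>real Q * frac (\<xi> * \<rho> ^ i)\<rfloor> = int c" "c \<in> C"
      using hit[OF \<xi>(1)] by blast
    moreover obtain c' where "c' \<in> A" "frac (\<xi> * \<rho> ^ i) \<in> J c'"
      using \<xi>(2)[of i] by (auto simp: K_def)
    ultimately show False using floorJ by (auto simp: A_def)
  qed
  moreover have "K = (\<Union>(a, b)\<in>(\<lambda>c. (lo c, hi c)) ` A. {a..b})" by (auto simp: K_def J_def)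
  moreover have "finite ((\<lambda>c. (lo c, hi c)) ` A)" by (simp add: A_def)
  ultimately show ?thesis using meas sub by blast
qed

end
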